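(* Let $(g,d,f,\xi)$ be an optimal solution of the SC-ST clearing problem and let $(\pi,\overline{\lambda})$ be an optimal solution of its dual problem. Let $\mathcal{G}^*=\{i\in\mathcal{G}:g_i>0\}$, $\mathcal{D}^*=\{j\in\mathcal{D}:d_j>0\}$, $\mathcal{L}^*=\{l\in\mathcal{L}:f_l>0\}$, $\mathcal{M}^*=\{m\in\mathcal{M}:\xi_m>0\}$ be the sets of cleared players. Then $\pi_i\ge\alpha^g_i$ for all $i\in\mathcal{G}^*$, $\pi_j\le\alpha^d_j$ for all $j\in\mathcal{D}^*$, $\pi_l\ge\alpha^f_l$ for all $l\in\mathcal{L}^*$, and $\pi_m\ge\alpha^\xi_m$ for all $m\in\mathcal{M}^*$.
   Context: Setting (space-time supply chain, SC-ST). $\mathcal{N}$ is a finite set of spatial nodes, $\mathcal{T}$ a finite ordered set of times, $\mathcal{S}=\mathcal{N}\times\mathcal{T}$ the set of space-time nodes $s=(n,t)$, $\mathcal{P}$ a finite set of products. There are finite sets of stakeholders (players): suppliers $\mathcal{G}$, consumers $\mathcal{D}$, transport providers $\mathcal{L}$, technology providers $\mathcal{M}$. - Supplier $i$: node $s(i)\in\mathcal{S}$, product $p(i)\in\mathcal{P}$, flow $g_i\ge0$, capacity $\overline{g}_i\ge0$, bid $\alpha^g_i\in\mathbb{R}$. - Consumer $j$: node $s(j)\in\mathcal{S}$, product $p(j)\in\mathcal{P}$, flow $d_j\ge0$, capacity $\overline{d}_j\ge0$, bid $\alpha^d_j\in\mathbb{R}$. - Transport provider $l$: base node $s_b(l)\in\mathcal{S}$,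 receiving node $s_r(l)\in\mathcal{S}$, product $p(l)\in\mathcal{P}$, flow $f_l\ge0$, capacity $\overline{f}_l\ge0$, bid $\alpha^f_l\ge0$. - Technology provider $m$: node $s(m)\in\mathcal{S}$, sets $\mathcal{P}^{con}_m,\mathcal{P}^{gen}_m\subset\mathcal{P}$ of consumed and generated products, yields $\gamma_{m,p}\ge0$ with $\gamma_{m,\bar p_m}=1$ for a reference product $\bar p_m\in\mathcal{P}^{con}_m$, flow $\xi_m\ge0$, capacity $\overline{\xi}_m\ge0$, bid $\alpha^\xi_m\ge0$. For $(s,p)\in\mathcal{S}\times\mathcal{P}$: $\mathcal{G}_{s,p}=\{i:s(i)=s,p(i)=p\}$, $\mathcal{D}_{s,p}=\{j:s(j)=s,p(j)=p\}$, $\mathcal{L}^{in}_{s,p}=\{l:s_r(l)=s,p(l)=p\}$, $\mathcal{L}^{out}_{s,p}=\{l:s_b(l)=s,p(l)=p\}$, $\mathcal{M}^{con}_{s,p}=\{m:s(m)=s,p\in\mathcal{P}^{con}_m\}$, $\mathcal{M}^{gen}_{s,p}=\{m:s(m)=s,p\in\mathcal{P}^{gen}_m\}$. SC-ST clearing problem (primal): maximize $\sum_j\alpha^d_jd_j-\sum_i\alpha^g_ig_i-\sum_l\alpha^f_lf_l-\sum_m\alpha^\xi_m\xi_m$ over nonnegative $(g,d,f,\xi)$ subject to the clearing constraints, for all $(s,p)\in\mathcal{S}\times\mathcal{P}$ (dual variable $\pi_{s,p}\in\mathbb{R}$, the clearing price), $$\sum_{i\in\mathcal{G}_{s,p}}g_i+\sum_{l\in\mathcal{L}^{in}_{s,p}}f_l+\sum_{m\in\mathcal{M}^{gen}_{s,p}}\gamma_{m,p}\xi_m=\sum_{j\in\mathcal{D}_{s,p}}d_j+\sum_{l\in\mathcal{L}^{out}_{s,p}}f_l+\sum_{m\in\mathcal{M}^{con}_{s,p}}\gamma_{m,p}\xi_m,$$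 and capacity constraints $g_i\le\overline{g}_i$, $d_j\le\overline{d}_j$, $f_l\le\overline{f}_l$, $\xi_m\le\overline{\xi}_m$ (dual variables $\overline{\lambda}_i,\overline{\lambda}_j,\overline{\lambda}_l,\overline{\lambda}_m\ge0$). Stakeholder prices: $\pi_i=\pi_{s(i),p(i)}$, $\pi_j=\pi_{s(j),p(j)}$, $\pi_l=\pi_{s_r(l),p(l)}-\pi_{s_b(l),p(l)}$, $\pi_m=\sum_{p\in\mathcal{P}^{gen}_m}\gamma_{m,p}\pi_{s(m),p}-\sum_{p\in\mathcal{P}^{con}_m}\gamma_{m,p}\pi_{s(m),p}$. Dual problem: minimize $\sum_i\overline{g}_i\overline{\lambda}_i+\sum_j\overline{d}_j\overline{\lambda}_j+\sum_l\overline{f}_l\overline{\lambda}_l+\sum_m\overline{\xi}_m\overline{\lambda}_m$ over $\pi$ (free) and $\overline{\lambda}\ge0$ subject to $\pi_i-\overline{\lambda}_i\le\alpha^g_i$, $\pi_j+\overline{\lambda}_j\ge\alpha^d_j$, $\pi_l-\overline{\lambda}_l\le\alpha^f_l$, $\pi_m-\overline{\lambda}_m\le\alpha^\xi_m$ for all players. *)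

theory Defs
  imports Complex_Main
begin

text \<open>Players are elements of explicit finite index sets; a space-time node is a pair
  (spatial node, time). Flows, prices and multipliers are total functions, and only their values on
  the index sets matter.\<close>

record ('n, 't, 'p, 'g, 'd, 'l, 'm) supply_chain =
  spatial_nodes :: "'n set"
  times :: "'t set"
  products :: "'p set"
  suppliers :: "'g set"
  consumers :: "'d set"
  transports :: "'l set"
  technologies :: "'m set"
  sup_node :: "'g \<Rightarrow> 'n \<times> 't"
  sup_product :: "'g \<Rightarrow> 'p"
  sup_cap :: "'g \<Rightarrow> real"
  sup_bid :: "'g \<Rightarrow> real"
  con_node :: "'d \<Rightarrow> 'n \<times> 't"
  con_product :: "'d \<Rightarrow> 'p"
  con_cap :: "'d \<Rightarrow> real"
  con_bid :: "'d \<Rightarrow> real"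
  trans_base :: "'l \<Rightarrow> 'n \<times> 't"
  trans_recv :: "'l \<Rightarrow> 'n \<times> 't"
  trans_product :: "'l \<Rightarrow> 'p"
  trans_cap :: "'l \<Rightarrow> real"
  trans_bid :: "'l \<Rightarrow> real"
  tech_node :: "'m \<Rightarrow> 'n \<times> 't"
  tech_con :: "'m \<Rightarrow> 'p set"
  tech_gen :: "'m \<Rightarrow> 'p set"
  tech_yield :: "'m \<Rightarrow> 'p \<Rightarrow> real"
  tech_ref :: "'m \<Rightarrow> 'p"
  tech_cap :: "'m \<Rightarrow> real"
  tech_bid :: "'m \<Rightarrow> real"

definition st_nodes :: "('n, 't, 'p, 'g, 'd, 'l, 'm) supply_chain \<Rightarrow> ('n \<times> 't) set" where
  "st_nodes C = spatial_nodes C \<times> times C"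

definition valid_supply_chain ::
  "('n, 't::linorder, 'p, 'g, 'd, 'l, 'm) supply_chain \<Rightarrow> bool" where
  "valid_supply_chain C \<longleftrightarrow>
     finite (spatial_nodes C) \<and> finite (times C) \<and> finite (products C) \<and>
     finite (suppliers C) \<and> finite (consumers C) \<and>
     finite (transports C) \<and> finite (technologies C) \<and>
     (\<forall>i\<in>suppliers C. sup_node C i \<in> st_nodes C \<and> sup_product C i \<in> products C \<and>
        0 \<le> sup_cap C i) \<and>
     (\<forall>j\<in>consumers C. con_node C j \<in> st_nodes C \<and> con_product C j \<in> products C \<and>
        0 \<le> con_cap C j) \<and>
     (\<forall>l\<in>transports C. trans_base C l \<in> st_nodes C \<and> trans_recv C l \<in> st_nodes C \<and>
        trans_product C l \<in> products C \<and> 0 \<le> trans_cap C l \<and> 0 \<le> trans_bid C l) \<and>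
     (\<forall>m\<in>technologies C. tech_node C m \<in> st_nodes C \<and>
        tech_con C m \<subseteq> products C \<and> tech_gen C m \<subseteq> products C \<and>
        (\<forall>p\<in>tech_con C m \<union> tech_gen C m. 0 \<le> tech_yield C m p) \<and>
        tech_ref C m \<in> tech_con C m \<and> tech_yield C m (tech_ref C m) = 1 \<and>
        0 \<le> tech_cap C m \<and> 0 \<le> tech_bid C m)"

definition sup_at ::
  "('n, 't, 'p, 'g, 'd, 'l, 'm) supply_chain \<Rightarrow> 'n \<times> 't \<Rightarrow> 'p \<Rightarrow> 'g set" where
  "sup_at C s p = {i \<in> suppliers C. sup_node C i = s \<and> sup_product C i = p}"

definition con_at ::
  "('n, 't, 'p, 'g, 'd, 'l, 'm) supply_chain \<Rightarrow> 'n \<times> 't \<Rightarrow> 'p \<Rightarrow> 'd set" where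
  "con_at C s p = {j \<in> consumers C. con_node C j = s \<and> con_product C j = p}"

definition trans_in ::
  "('n, 't, 'p, 'g, 'd, 'l, 'm) supply_chain \<Rightarrow> 'n \<times> 't \<Rightarrow> 'p \<Rightarrow> 'l set" where
  "trans_in C s p = {l \<in> transports C. trans_recv C l = s \<and> trans_product C l = p}"

definition trans_out ::
  "('n, 't, 'p, 'g, 'd, 'l, 'm) supply_chain \<Rightarrow> 'n \<times> 't \<Rightarrow> 'p \<Rightarrow> 'l set" where
  "trans_out C s p = {l \<in> transports C. trans_base C l = s \<and> trans_product C l = p}"

definition tech_con_at ::
  "('n, 't, 'p, 'g, 'd, 'l, 'm) supply_chain \<Rightarrow> 'n \<times> 't \<Rightarrow> 'p \<Rightarrow> 'm set" where
  "tech_con_at C s p = {m \<in> technologies C. tech_node C m = s \<and> p \<in> tech_con C m}"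

definition tech_gen_at ::
  "('n, 't, 'p, 'g, 'd, 'l, 'm) supply_chain \<Rightarrow> 'n \<times> 't \<Rightarrow> 'p \<Rightarrow> 'm set" where
  "tech_gen_at C s p = {m \<in> technologies C. tech_node C m = s \<and> p \<in> tech_gen C m}"

definition primal_objective ::
  "('n, 't, 'p, 'g, 'd, 'l, 'm) supply_chain \<Rightarrow>
   ('g \<Rightarrow> real) \<Rightarrow> ('d \<Rightarrow> real) \<Rightarrow> ('l \<Rightarrow> real) \<Rightarrow> ('m \<Rightarrow> real) \<Rightarrow> real" where
  "primal_objective C g d f \<xi> =
     (\<Sum>j\<in>consumers C. con_bid C j * d j) - (\<Sum>i\<in>suppliers C. sup_bid C i * g i)
     - (\<Sum>l\<in>transports C. trans_bid C l * f l) - (\<Sum>m\<in>technologies C. tech_bid C m * \<xi> m)"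

definition primal_feasible ::
  "('n, 't, 'p, 'g, 'd, 'l, 'm) supply_chain \<Rightarrow>
   ('g \<Rightarrow> real) \<Rightarrow> ('d \<Rightarrow> real) \<Rightarrow> ('l \<Rightarrow> real) \<Rightarrow> ('m \<Rightarrow> real) \<Rightarrow> bool" where
  "primal_feasible C g d f \<xi> \<longleftrightarrow>
     (\<forall>s\<in>st_nodes C. \<forall>p\<in>products C.
        (\<Sum>i\<in>sup_at C s p. g i) + (\<Sum>l\<in>trans_in C s p. f l)
          + (\<Sum>m\<in>tech_gen_at C s p. tech_yield C m p * \<xi> m)
        = (\<Sum>j\<in>con_at C s p. d j) + (\<Sum>l\<in>trans_out C s p. f l)
          + (\<Sum>m\<in>tech_con_at C s p. tech_yield C m p * \<xi> m)) \<and>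
     (\<forall>i\<in>suppliers C. 0 \<le> g i \<and> g i \<le> sup_cap C i) \<and>
     (\<forall>j\<in>consumers C. 0 \<le> d j \<and> d j \<le> con_cap C j) \<and>
     (\<forall>l\<in>transports C. 0 \<le> f l \<and> f l \<le> trans_cap C l) \<and>
     (\<forall>m\<in>technologies C. 0 \<le> \<xi> m \<and> \<xi> m \<le> tech_cap C m)"

definition primal_optimal ::
  "('n, 't, 'p, 'g, 'd, 'l, 'm) supply_chain \<Rightarrow>
   ('g \<Rightarrow> real) \<Rightarrow> ('d \<Rightarrow> real) \<Rightarrow> ('l \<Rightarrow> real) \<Rightarrow> ('m \<Rightarrow> real) \<Rightarrow> bool" where
  "primal_optimal C g d f \<xi> \<longleftrightarrow>
     primal_feasible C g d f \<xi> \<and>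
     (\<forall>g' d' f' \<xi>'. primal_feasible C g' d' f' \<xi>' \<longrightarrow>
        primal_objective C g' d' f' \<xi>' \<le> primal_objective C g d f \<xi>)"

definition sup_price ::
  "('n, 't, 'p, 'g, 'd, 'l, 'm) supply_chain \<Rightarrow> ('n \<times> 't \<Rightarrow> 'p \<Rightarrow> real) \<Rightarrow> 'g \<Rightarrow> real" where
  "sup_price C \<pi> i = \<pi> (sup_node C i) (sup_product C i)"

definition con_price ::
  "('n, 't, 'p, 'g, 'd, 'l, 'm) supply_chain \<Rightarrow> ('n \<times> 't \<Rightarrow> 'p \<Rightarrow> real) \<Rightarrow> 'd \<Rightarrow> real" where
  "con_price C \<pi> j = \<pi> (con_node C j) (con_product C j)"

definition trans_price ::
  "('n, 't, 'p, 'g, 'd, 'l, 'm) supply_chain \<Rightarrow> ('n \<times> 't \<Rightarrow> 'p \<Rightarrow> real) \<Rightarrow> 'l \<Rightarrow> real" where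
  "trans_price C \<pi> l =
     \<pi> (trans_recv C l) (trans_product C l) - \<pi> (trans_base C l) (trans_product C l)"

definition tech_price ::
  "('n, 't, 'p, 'g, 'd, 'l, 'm) supply_chain \<Rightarrow> ('n \<times> 't \<Rightarrow> 'p \<Rightarrow> real) \<Rightarrow> 'm \<Rightarrow> real" where
  "tech_price C \<pi> m =
     (\<Sum>p\<in>tech_gen C m. tech_yield C m p * \<pi> (tech_node C m) p)
     - (\<Sum>p\<in>tech_con C m. tech_yield C m p * \<pi> (tech_node C m) p)"

definition dual_objective ::
  "('n, 't, 'p, 'g, 'd, 'l, 'm) supply_chain \<Rightarrow>
   ('g \<Rightarrow> real) \<Rightarrow> ('d \<Rightarrow> real) \<Rightarrow> ('l \<Rightarrow> real) \<Rightarrow> ('m \<Rightarrow> real) \<Rightarrow> real" where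
  "dual_objective C lam_g lam_d lam_f lam_\<xi> =
     (\<Sum>i\<in>suppliers C. sup_cap C i * lam_g i) + (\<Sum>j\<in>consumers C. con_cap C j * lam_d j)
     + (\<Sum>l\<in>transports C. trans_cap C l * lam_f l) + (\<Sum>m\<in>technologies C. tech_cap C m * lam_\<xi> m)"

definition dual_feasible ::
  "('n, 't, 'p, 'g, 'd, 'l, 'm) supply_chain \<Rightarrow> ('n \<times> 't \<Rightarrow> 'p \<Rightarrow> real) \<Rightarrow>
   ('g \<Rightarrow> real) \<Rightarrow> ('d \<Rightarrow> real) \<Rightarrow> ('l \<Rightarrow> real) \<Rightarrow> ('m \<Rightarrow> real) \<Rightarrow> bool" where
  "dual_feasible C \<pi> lam_g lam_d lam_f lam_\<xi> \<longleftrightarrow>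
     (\<forall>i\<in>suppliers C. 0 \<le> lam_g i \<and> sup_price C \<pi> i - lam_g i \<le> sup_bid C i) \<and>
     (\<forall>j\<in>consumers C. 0 \<le> lam_d j \<and> con_price C \<pi> j + lam_d j \<ge> con_bid C j) \<and>
     (\<forall>l\<in>transports C. 0 \<le> lam_f l \<and> trans_price C \<pi> l - lam_f l \<le> trans_bid C l) \<and>
     (\<forall>m\<in>technologies C. 0 \<le> lam_\<xi> m \<and> tech_price C \<pi> m - lam_\<xi> m \<le> tech_bid C m)"

definition dual_optimal ::
  "('n, 't, 'p, 'g, 'd, 'l, 'm) supply_chain \<Rightarrow> ('n \<times> 't \<Rightarrow> 'p \<Rightarrow> real) \<Rightarrow>
   ('g \<Rightarrow> real) \<Rightarrow> ('d \<Rightarrow> real) \<Rightarrow> ('l \<Rightarrow> real) \<Rightarrow> ('m \<Rightarrow> real) \<Rightarrow> bool" where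
  "dual_optimal C \<pi> lam_g lam_d lam_f lam_\<xi> \<longleftrightarrow>
     dual_feasible C \<pi> lam_g lam_d lam_f lam_\<xi> \<and>
     (\<forall>\<pi>' lam_g' lam_d' lam_f' lam_\<xi>'. dual_feasible C \<pi>' lam_g' lam_d' lam_f' lam_\<xi>' \<longrightarrow>
        dual_objective C lam_g lam_d lam_f lam_\<xi> \<le> dual_objective C lam_g' lam_d' lam_f' lam_\<xi>')"

definition cleared :: "'a set \<Rightarrow> ('a \<Rightarrow> real) \<Rightarrow> 'a set" where
  "cleared A x = {a \<in> A. x a > 0}"

end

theory Submission
  imports Defs "HOL-Analysis.Function_Topology"
begin

text \<open>The theorem is one half of complementary slackness. Treat all four kinds of players alike:
  a player \<open>k\<close> with flow \<open>x k\<close> puts \<open>a e k * x k\<close> into the market \<open>e = (s, p)\<close> (a negative amount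
  is a withdrawal) at unit cost \<open>c k\<close>. A consumer injects \<open>-1\<close> and costs minus its bid. Clearing
  then says that every market nets to zero, the primal problem is to minimise \<open>\<Sum>k. c k * x k\<close>
  over balanced flows in the box \<open>[0, u]\<close>, and all four claims become \<open>0 \<le> r k\<close> whenever \<open>0 < x k\<close>,
  where the surplus \<open>r k = (\<Sum>e. \<pi> e * a e k) - c k\<close> is what \<open>k\<close> earns per unit of flow.
  In the dual problem the cheapest admissible multiplier is \<open>max 0 (r k)\<close>, so optimal prices minimise
  the piecewise linear function \<open>\<Sum>k. u k * max 0 (r k)\<close>.

  A balanced flow earns nothing from the prices in total, so its cost is \<open>- (\<Sum>k. r k * x k)\<close>. This is
  at least \<open>- (\<Sum>k. u k * max 0 (r k))\<close>, and in case of equality \<open>x k\<close> vanishes wherever \<open>r k < 0\<close>.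
  So it is enough that some balanced flow attains the bound, that is, that some balanced flow is at
  capacity where \<open>r k > 0\<close> and zero where \<open>r k < 0\<close>: the optimal flow then attains the bound too.
  This is the content of strong duality, and it is obtained here from optimality of the prices.
  No small price change can lower the dual function (\<open>dual_minimum_direction\<close>), which means that no
  direction \<open>v\<close> separates the imbalances of the flows in this smaller box from zero. By a least
  squares argument on the compact box, zero is then itself one of these imbalances
  (\<open>balanced_point_in_box\<close>). The conclusion is drawn in \<open>box_lp_complementary_slackness\<close>, and the
  rest translates the supply chain into this form.\<close>

section \<open>Balanced points in a box\<close>

lemma compact_function_box:
  fixes lo hi :: "'k \<Rightarrow> real"
  shows "compact {x. \<forall>k. lo k \<le> x k \<and> x k \<le> hi k}"
proof -
  have "{x. \<forall>k. lo k \<le> x k \<and> x k \<le> hi k} = PiE UNIV (\<lambda>k. {lo k..hi k})"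
    by (auto simp: PiE_def)
  moreover have "compactin (product_topology (\<lambda>k::'k. euclidean :: real topology) UNIV)
      (PiE UNIV (\<lambda>k. {lo k..hi k}))"
    by (simp add: compactin_PiE)
  ultimately show ?thesis
    by (simp add: euclidean_product_topology)
qed

text \<open>A point of the box whose image under \<open>a\<close> has minimal Euclidean norm exists by compactness.
  The inequality is its first-order optimality condition: moving towards any other point \<open>y\<close> of the
  box cannot decrease the squared norm.\<close>
lemma box_least_squares:
  fixes a :: "'e \<Rightarrow> 'k \<Rightarrow> real" and lo hi :: "'k \<Rightarrow> real"
  assumes "finite K" and "\<forall>k\<in>K. lo k \<le> hi k"
  obtains x where "\<forall>k\<in>K. lo k \<le> x k \<and> x k \<le> hi k"
    and "\<And>y. \<forall>k\<in>K. lo k \<le> y k \<and> y k \<le> hi k \<Longrightarrow>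
      0 \<le> (\<Sum>e\<in>E. (\<Sum>k\<in>K. a e k * x k) * (\<Sum>k\<in>K. a e k * (y k - x k)))"
proof -
  \<comment> \<open>Coordinates outside \<open>K\<close> are pinned to 0, since the box is compact only if all coordinates are bounded.\<close>
  define B where "B = {x. \<forall>k. (if k \<in> K then lo k else 0) \<le> x k \<and> x k \<le> (if k \<in> K then hi k else 0)}"
  define q where "q x = (\<Sum>e\<in>E. (\<Sum>k\<in>K. a e k * x k)\<^sup>2)" for x
  have "compact B"
    unfolding B_def by (rule compact_function_box)
  moreover have "(\<lambda>k. if k \<in> K then lo k else 0) \<in> B"
    using assms(2) by (auto simp: B_def)
  moreover have "continuous_on B q"
    unfolding q_def
    by (intro continuous_intros continuous_on_subset[OF continuous_on_product_coordinates]) auto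
  ultimately obtain x where xB: "x \<in> B" and xmin: "\<forall>y\<in>B. q x \<le> q y"
    using continuous_attains_inf[of B q] by blast
  have xbox: "\<forall>k\<in>K. lo k \<le> x k \<and> x k \<le> hi k"
    using xB by (auto simp: B_def split: if_splits)
  moreover have "0 \<le> (\<Sum>e\<in>E. (\<Sum>k\<in>K. a e k * x k) * (\<Sum>k\<in>K. a e k * (y k - x k)))" (is "0 \<le> ?D")
    if ybox: "\<forall>k\<in>K. lo k \<le> y k \<and> y k \<le> hi k" for y
  proof -
    define Q where "Q = (\<Sum>e\<in>E. (\<Sum>k\<in>K. a e k * (y k - x k))\<^sup>2)"
    have "0 \<le> 2 * ?D + s * Q" if s: "0 < s" "s \<le> 1" for s
    proof -
      define z where "z k = (if k \<in> K then x k + s * (y k - x k) else 0)" for k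
      have "z \<in> B"
        unfolding B_def mem_Collect_eq
      proof
        fix k
        have "lo k \<le> (1 - s) * x k + s * y k" "(1 - s) * x k + s * y k \<le> hi k" if "k \<in> K"
          using convex_bound_le[of "x k" "hi k" "y k" "1 - s" s]
            convex_bound_le[of "- x k" "- lo k" "- y k" "1 - s" s] xbox ybox s that by auto
        then show "(if k \<in> K then lo k else 0) \<le> z k \<and> z k \<le> (if k \<in> K then hi k else 0)"
          by (auto simp: z_def algebra_simps)
      qed
      have "q z = q x + s * (2 * ?D + s * Q)"
      proof -
        have "(\<Sum>k\<in>K. a e k * z k) = (\<Sum>k\<in>K. a e k * x k) + s * (\<Sum>k\<in>K. a e k * (y k - x k))" for e
          by (simp add: z_def sum_distrib_left sum.distrib[symmetric] algebra_simps cong: sum.cong)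
        then show ?thesis
          unfolding q_def Q_def
          by (simp add: power2_sum sum.distrib sum_distrib_left algebra_simps power2_eq_square)
      qed
      moreover have "q x \<le> q z"
        using xmin \<open>z \<in> B\<close> by blast
      ultimately show ?thesis
        using s by (simp add: zero_le_mult_iff)
    qed
    note step_bound = this
    show "0 \<le> ?D"
    proof (rule tendsto_lowerbound)
      have "((\<lambda>s. (2 * ?D + s * Q) / 2) \<longlongrightarrow> (2 * ?D + 0 * Q) / 2) (at_right 0)"
        by (intro tendsto_intros) simp
      then show "((\<lambda>s. (2 * ?D + s * Q) / 2) \<longlongrightarrow> ?D) (at_right 0)"
        by simp
      show "\<forall>\<^sub>F s in at_right 0. 0 \<le> (2 * ?D + s * Q) / 2"
        unfolding eventually_at_right_field using step_bound
        by (intro exI[of _ 1]) auto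
    qed simp
  qed
  ultimately show ?thesis
    by (rule that)
qed

text \<open>This is the separation theorem for the origin and the image of a box, in contrapositive form.
  The direction to test is the imbalance \<open>w\<close> of the least squares point: every point of the box
  has image at least \<open>\<Sum>e. (w e)\<^sup>2\<close> in direction \<open>w\<close>, so the hypothesis forces \<open>w = 0\<close>.\<close>
lemma balanced_point_in_box:
  fixes a :: "'e \<Rightarrow> 'k \<Rightarrow> real" and lo hi :: "'k \<Rightarrow> real"
  assumes "finite E" "finite K" "\<forall>k\<in>K. lo k \<le> hi k"
    and dir: "\<And>v. \<exists>y. (\<forall>k\<in>K. lo k \<le> y k \<and> y k \<le> hi k) \<and>
      (\<Sum>k\<in>K. y k * (\<Sum>e\<in>E. v e * a e k)) \<le> 0"
  obtains x where "\<forall>k\<in>K. lo k \<le> x k \<and> x k \<le> hi k" and "\<forall>e\<in>E. (\<Sum>k\<in>K. a e k * x k) = 0"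
proof -
  obtain x where xbox: "\<forall>k\<in>K. lo k \<le> x k \<and> x k \<le> hi k"
    and xopt: "\<And>y. \<forall>k\<in>K. lo k \<le> y k \<and> y k \<le> hi k \<Longrightarrow>
      0 \<le> (\<Sum>e\<in>E. (\<Sum>k\<in>K. a e k * x k) * (\<Sum>k\<in>K. a e k * (y k - x k)))"
    using box_least_squares[OF assms(2,3), where E = E and a = a] by blast
  define w where "w e = (\<Sum>k\<in>K. a e k * x k)" for e
  obtain y where ybox: "\<forall>k\<in>K. lo k \<le> y k \<and> y k \<le> hi k"
    and y: "(\<Sum>k\<in>K. y k * (\<Sum>e\<in>E. w e * a e k)) \<le> 0"
    using dir by blast
  have "(\<Sum>k\<in>K. y k * (\<Sum>e\<in>E. w e * a e k)) = (\<Sum>e\<in>E. w e * (\<Sum>k\<in>K. a e k * y k))"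
    unfolding sum_distrib_left by (subst sum.swap) (simp add: mult_ac)
  moreover have "0 \<le> (\<Sum>e\<in>E. w e * (\<Sum>k\<in>K. a e k * y k)) - (\<Sum>e\<in>E. (w e)\<^sup>2)"
    using xopt[OF ybox]
    by (simp add: w_def power2_eq_square algebra_simps sum_subtractf)
  ultimately have "(\<Sum>e\<in>E. (w e)\<^sup>2) \<le> 0"
    using y by linarith
  then have "\<forall>e\<in>E. w e = 0"
    using sum_nonneg_eq_0_iff[OF \<open>finite E\<close>, of "\<lambda>e. (w e)\<^sup>2"] sum_nonneg[of E "\<lambda>e. (w e)\<^sup>2"]
    by (auto simp: order_antisym)
  then show ?thesis
    using that xbox by (simp add: w_def)
qed

section \<open>Complementary slackness for linear programs over a box\<close>

lemma small_step_reverses_no_sign: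
  fixes r b :: "'k \<Rightarrow> real"
  assumes "finite K"
  obtains t where "0 < t" and "\<forall>k\<in>K. r k \<noteq> 0 \<longrightarrow> t * \<bar>b k\<bar> \<le> \<bar>r k\<bar>"
proof -
  have "\<forall>\<^sub>F t in at_right 0. r k \<noteq> 0 \<longrightarrow> t * \<bar>b k\<bar> \<le> \<bar>r k\<bar>" for k
  proof (cases "r k = 0")
    case False
    have "((\<lambda>t. t * \<bar>b k\<bar>) \<longlongrightarrow> 0 * \<bar>b k\<bar>) (at_right 0)"
      by (intro tendsto_intros)
    then have "\<forall>\<^sub>F t in at_right 0. t * \<bar>b k\<bar> < \<bar>r k\<bar>"
      using False by (intro order_tendstoD) auto
    then show ?thesis
      by (rule eventually_mono) simp
  qed simp
  then have "\<forall>\<^sub>F t in at_right (0::real). \<forall>k\<in>K. r k \<noteq> 0 \<longrightarrow> t * \<bar>b k\<bar> \<le> \<bar>r k\<bar>"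
    using assms by (simp add: eventually_ball_finite)
  then have "\<forall>\<^sub>F t in at_right (0::real). 0 < t \<and> (\<forall>k\<in>K. r k \<noteq> 0 \<longrightarrow> t * \<bar>b k\<bar> \<le> \<bar>r k\<bar>)"
    using eventually_at_right_less by (rule eventually_conj[rotated])
  then show ?thesis
    using that eventually_happens'[OF trivial_limit_at_right_real] by blast
qed

text \<open>The directional derivative of \<open>\<Sum>k. u k * max 0 (r \<pi> k)\<close> at its minimum is nonnegative. For a
  step small enough to reverse the sign of no \<open>r \<pi> k\<close>, the function is exactly linear along the
  direction \<open>- v\<close>, with slope minus the sum in the conclusion. The point \<open>y\<close> holds the coefficients
  of the subgradient that this direction selects: they are determined where \<open>r \<pi> k\<close> is nonzero, and
  where \<open>r \<pi> k = 0\<close> the sign of \<open>\<Sum>e. v e * a e k\<close> decides between the two ends of the interval.\<close>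
lemma dual_minimum_direction:
  fixes a :: "'e \<Rightarrow> 'k \<Rightarrow> real" and c u :: "'k \<Rightarrow> real" and \<pi> v :: "'e \<Rightarrow> real" and E :: "'e set"
  defines "r \<equiv> \<lambda>\<pi> k. (\<Sum>e\<in>E. \<pi> e * a e k) - c k"
  assumes "finite K" "\<forall>k\<in>K. 0 \<le> u k"
    and dmin: "\<And>\<pi>'. (\<Sum>k\<in>K. u k * max 0 (r \<pi> k)) \<le> (\<Sum>k\<in>K. u k * max 0 (r \<pi>' k))"
  shows "\<exists>y. (\<forall>k\<in>K. (if 0 < r \<pi> k then u k else 0) \<le> y k \<and> y k \<le> (if r \<pi> k < 0 then 0 else u k)) \<and>
    (\<Sum>k\<in>K. y k * (\<Sum>e\<in>E. v e * a e k)) \<le> 0"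
proof -
  define b where "b k = (\<Sum>e\<in>E. v e * a e k)" for k
  obtain t where t: "0 < t" "\<forall>k\<in>K. r \<pi> k \<noteq> 0 \<longrightarrow> t * \<bar>b k\<bar> \<le> \<bar>r \<pi> k\<bar>"
    using small_step_reverses_no_sign[OF \<open>finite K\<close>] by blast
  define y where "y k = (if 0 < r \<pi> k \<or> r \<pi> k = 0 \<and> b k < 0 then u k else 0)" for k
  have shift: "r (\<lambda>e. \<pi> e - t * v e) k = r \<pi> k - t * b k" for k
    by (simp add: r_def b_def algebra_simps sum_subtractf sum_distrib_left)
  have "u k * max 0 (r (\<lambda>e. \<pi> e - t * v e) k) = u k * max 0 (r \<pi> k) - t * (y k * b k)"
    if "k \<in> K" for k
  proof -
    consider "0 < r \<pi> k" | "r \<pi> k < 0" | "r \<pi> k = 0" "b k < 0" | "r \<pi> k = 0" "0 \<le> b k"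
      by linarith
    then show ?thesis
    proof cases
      case 1
      moreover have "t * b k \<le> t * \<bar>b k\<bar>"
        using t(1) by simp
      ultimately have "max 0 (r \<pi> k - t * b k) = r \<pi> k - t * b k"
        using t(2) that by fastforce
      then show ?thesis
        using 1 by (simp add: shift y_def algebra_simps)
    next
      case 2
      moreover have "- (t * b k) \<le> t * \<bar>b k\<bar>"
        using t(1) by (simp flip: mult_minus_right)
      ultimately have "max 0 (r \<pi> k - t * b k) = 0"
        using t(2) that by fastforce
      then show ?thesis
        using 2 by (simp add: shift y_def)
    next
      case 3
      then show ?thesis
        using t(1) by (simp add: shift y_def mult_pos_neg max_def mult_le_0_iff zero_le_mult_iff)
    next
      case 4
      then show ?thesis
        using t(1) by (simp add: shift y_def max_def mult_le_0_iff zero_le_mult_iff)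
    qed
  qed
  then have "(\<Sum>k\<in>K. u k * max 0 (r (\<lambda>e. \<pi> e - t * v e) k))
      = (\<Sum>k\<in>K. u k * max 0 (r \<pi> k)) - t * (\<Sum>k\<in>K. y k * b k)"
    by (simp add: sum_subtractf sum_distrib_left)
  then have "t * (\<Sum>k\<in>K. y k * b k) \<le> 0"
    using dmin[of "\<lambda>e. \<pi> e - t * v e"] by linarith
  then have "(\<Sum>k\<in>K. y k * b k) \<le> 0"
    using t(1) by (simp add: mult_le_0_iff)
  moreover have "\<forall>k\<in>K. (if 0 < r \<pi> k then u k else 0) \<le> y k \<and> y k \<le> (if r \<pi> k < 0 then 0 else u k)"
    using assms(3) by (auto simp: y_def)
  ultimately show ?thesis
    unfolding b_def by blast
qed

text \<open>The hypothesis \<open>dmin\<close> is dual optimality with the capacity multipliers eliminated. It yields a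
  balanced point \<open>z\<close> that earns the full bound \<open>\<Sum>k. u k * max 0 (r k)\<close>. The cost of \<open>x\<close> is
  no larger than that of \<open>z\<close>, so \<open>x\<close> earns it as well, and since \<open>r k * x k \<le> u k * max 0 (r k)\<close> for
  each \<open>k\<close>, equality holds for each \<open>k\<close>.\<close>
lemma box_lp_complementary_slackness:
  fixes a :: "'e \<Rightarrow> 'k \<Rightarrow> real" and c u x :: "'k \<Rightarrow> real" and \<pi> :: "'e \<Rightarrow> real"
  assumes fin: "finite E" "finite K" and u: "\<forall>k\<in>K. 0 \<le> u k"
    and xbal: "\<forall>e\<in>E. (\<Sum>k\<in>K. a e k * x k) = 0"
    and xbox: "\<forall>k\<in>K. 0 \<le> x k \<and> x k \<le> u k"
    and xopt: "\<And>y. \<forall>e\<in>E. (\<Sum>k\<in>K. a e k * y k) = 0 \<Longrightarrow> \<forall>k\<in>K. 0 \<le> y k \<and> y k \<le> u k \<Longrightarrow>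
      (\<Sum>k\<in>K. c k * x k) \<le> (\<Sum>k\<in>K. c k * y k)"
    and dmin: "\<And>\<pi>'. (\<Sum>k\<in>K. u k * max 0 ((\<Sum>e\<in>E. \<pi> e * a e k) - c k))
      \<le> (\<Sum>k\<in>K. u k * max 0 ((\<Sum>e\<in>E. \<pi>' e * a e k) - c k))"
    and k: "k \<in> K" "0 < x k"
  shows "c k \<le> (\<Sum>e\<in>E. \<pi> e * a e k)"
proof -
  define r where "r k = (\<Sum>e\<in>E. \<pi> e * a e k) - c k" for k
  obtain z where zbox: "\<forall>k\<in>K. (if 0 < r k then u k else 0) \<le> z k \<and> z k \<le> (if r k < 0 then 0 else u k)"
    and zbal: "\<forall>e\<in>E. (\<Sum>k\<in>K. a e k * z k) = 0"
  proof (rule balanced_point_in_box[OF fin, where a = a])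
    show "\<forall>k\<in>K. (if 0 < r k then u k else 0) \<le> (if r k < 0 then 0 else u k)"
      using u by simp
    show "\<exists>y. (\<forall>k\<in>K. (if 0 < r k then u k else 0) \<le> y k \<and> y k \<le> (if r k < 0 then 0 else u k)) \<and>
        (\<Sum>k\<in>K. y k * (\<Sum>e\<in>E. v e * a e k)) \<le> 0" for v
      unfolding r_def by (rule dual_minimum_direction[OF fin(2) u dmin])
  qed
  have surplus: "(\<Sum>k\<in>K. r k * y k) = - (\<Sum>k\<in>K. c k * y k)"
    if "\<forall>e\<in>E. (\<Sum>k\<in>K. a e k * y k) = 0" for y
  proof -
    have "(\<Sum>k\<in>K. (\<Sum>e\<in>E. \<pi> e * a e k) * y k) = (\<Sum>e\<in>E. \<pi> e * (\<Sum>k\<in>K. a e k * y k))"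
      unfolding sum_distrib_left sum_distrib_right by (subst sum.swap) (simp add: mult_ac)
    also have "\<dots> = 0"
      using that by simp
    finally show ?thesis
      by (simp add: r_def algebra_simps sum_subtractf)
  qed
  have z: "r k * z k = u k * max 0 (r k)" if "k \<in> K" for k
  proof -
    have "0 < r k \<Longrightarrow> z k = u k" "r k < 0 \<Longrightarrow> z k = 0"
      using zbox that by force+
    then show ?thesis
      by (cases "r k" "0::real" rule: linorder_cases) auto
  qed
  have "\<forall>k\<in>K. 0 \<le> z k \<and> z k \<le> u k"
    using zbox u by (fastforce split: if_splits)
  then have "(\<Sum>k\<in>K. r k * z k) \<le> (\<Sum>k\<in>K. r k * x k)"
    using xopt[OF zbal] surplus[OF zbal] surplus[OF xbal] by simp
  then have le: "(\<Sum>k\<in>K. u k * max 0 (r k) - r k * x k) \<le> 0"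
    by (simp add: sum_subtractf z)
  have nonneg: "0 \<le> u k * max 0 (r k) - r k * x k" if "k \<in> K" for k
  proof (cases "0 \<le> r k")
    case True
    then have "r k * x k \<le> r k * u k"
      using xbox that by (intro mult_left_mono) auto
    then show ?thesis
      using True by (simp add: max_def mult.commute)
  next
    case False
    then have "r k * x k \<le> 0"
      using xbox that by (intro mult_nonpos_nonneg) auto
    then show ?thesis
      using False by (simp add: max_def)
  qed
  have "0 \<le> (\<Sum>k\<in>K. u k * max 0 (r k) - r k * x k)"
    using nonneg by (rule sum_nonneg)
  with le have "(\<Sum>k\<in>K. u k * max 0 (r k) - r k * x k) = 0"
    by (rule antisym)
  then have "u k * max 0 (r k) - r k * x k = 0"
    using sum_nonneg_eq_0_iff[OF fin(2), of "\<lambda>k. u k * max 0 (r k) - r k * x k"] nonneg k(1) by simp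
  then have "0 \<le> r k"
    using k(2) by (cases "0 \<le> r k") (auto simp: max_def)
  then show ?thesis
    by (simp add: r_def)
qed

section \<open>The supply chain as a linear program over a box\<close>

definition players ::
  "('n, 't, 'p, 'g, 'd, 'l, 'm) supply_chain \<Rightarrow> ('g + 'd + 'l + 'm) set" where
  "players C = suppliers C <+> (consumers C <+> (transports C <+> technologies C))"

definition profile ::
  "('g \<Rightarrow> real) \<Rightarrow> ('d \<Rightarrow> real) \<Rightarrow> ('l \<Rightarrow> real) \<Rightarrow> ('m \<Rightarrow> real) \<Rightarrow>
   'g + 'd + 'l + 'm \<Rightarrow> real" where
  "profile g d f \<xi> = case_sum g (case_sum d (case_sum f \<xi>))"

text \<open>The signed incidence matrix of the clearing constraints: the net amount of product \<open>p\<close> that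
  one unit of flow of a player adds to node \<open>s\<close>. The two terms for a transport provider cancel when
  its base and receiving nodes agree, as do those for a technology provider that both consumes and
  generates \<open>p\<close>.\<close>
definition injection ::
  "('n, 't, 'p, 'g, 'd, 'l, 'm) supply_chain \<Rightarrow> ('n \<times> 't) \<times> 'p \<Rightarrow> 'g + 'd + 'l + 'm \<Rightarrow> real" where
  "injection C = (\<lambda>(s, p). profile
     (\<lambda>i. of_bool (sup_node C i = s \<and> sup_product C i = p))
     (\<lambda>j. - of_bool (con_node C j = s \<and> con_product C j = p))
     (\<lambda>l. of_bool (trans_recv C l = s \<and> trans_product C l = p)
        - of_bool (trans_base C l = s \<and> trans_product C l = p))
     (\<lambda>m. of_bool (tech_node C m = s \<and> p \<in> tech_gen C m) * tech_yield C m p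
        - of_bool (tech_node C m = s \<and> p \<in> tech_con C m) * tech_yield C m p))"

lemma profile_simps [simp]:
  "profile g d f \<xi> (Inl i) = g i"
  "profile g d f \<xi> (Inr (Inl j)) = d j"
  "profile g d f \<xi> (Inr (Inr (Inl l))) = f l"
  "profile g d f \<xi> (Inr (Inr (Inr m))) = \<xi> m"
  by (simp_all add: profile_def)

lemma ball_players:
  "(\<forall>k\<in>players C. P k) \<longleftrightarrow>
     (\<forall>i\<in>suppliers C. P (Inl i)) \<and> (\<forall>j\<in>consumers C. P (Inr (Inl j))) \<and>
     (\<forall>l\<in>transports C. P (Inr (Inr (Inl l)))) \<and> (\<forall>m\<in>technologies C. P (Inr (Inr (Inr m))))"
  by (auto simp: players_def)

lemma profile_surj: "\<exists>g d f \<xi>. x = profile g d f \<xi>"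
proof -
  have "x = profile (\<lambda>i. x (Inl i)) (\<lambda>j. x (Inr (Inl j))) (\<lambda>l. x (Inr (Inr (Inl l))))
      (\<lambda>m. x (Inr (Inr (Inr m))))"
    by (auto simp: profile_def fun_eq_iff split: sum.split)
  then show ?thesis by blast
qed

lemma valid_finite:
  assumes "valid_supply_chain C"
  shows "finite (st_nodes C)" "finite (products C)" "finite (suppliers C)" "finite (consumers C)"
    "finite (transports C)" "finite (technologies C)"
  using assms by (auto simp: valid_supply_chain_def st_nodes_def)

lemma sum_players:
  assumes "valid_supply_chain C"
  shows "(\<Sum>k\<in>players C. h k) = (\<Sum>i\<in>suppliers C. h (Inl i)) + (\<Sum>j\<in>consumers C. h (Inr (Inl j)))
     + (\<Sum>l\<in>transports C. h (Inr (Inr (Inl l)))) + (\<Sum>m\<in>technologies C. h (Inr (Inr (Inr m))))"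
  unfolding players_def using valid_finite[OF assms]
  by (simp add: sum.Plus comp_def add.assoc)

lemma finite_players: "valid_supply_chain C \<Longrightarrow> finite (players C)"
  unfolding players_def using valid_finite by (simp add: valid_finite)

lemma net_injection:
  assumes "valid_supply_chain C"
  shows "(\<Sum>k\<in>players C. injection C (s, p) k * profile g d f \<xi> k) =
     ((\<Sum>i\<in>sup_at C s p. g i) + (\<Sum>l\<in>trans_in C s p. f l)
          + (\<Sum>m\<in>tech_gen_at C s p. tech_yield C m p * \<xi> m))
     - ((\<Sum>j\<in>con_at C s p. d j) + (\<Sum>l\<in>trans_out C s p. f l)
          + (\<Sum>m\<in>tech_con_at C s p. tech_yield C m p * \<xi> m))"
  using valid_finite[OF assms]
  by (simp add: sum_players[OF assms] injection_def sup_at_def con_at_def trans_in_def trans_out_def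
      tech_gen_at_def tech_con_at_def left_diff_distrib sum_subtractf sum_negf mult.assoc
      Int_def)

lemma primal_feasible_iff:
  assumes "valid_supply_chain C"
  shows "primal_feasible C g d f \<xi> \<longleftrightarrow>
    (\<forall>e\<in>st_nodes C \<times> products C. (\<Sum>k\<in>players C. injection C e k * profile g d f \<xi> k) = 0) \<and>
    (\<forall>k\<in>players C. 0 \<le> profile g d f \<xi> k \<and>
       profile g d f \<xi> k \<le> profile (sup_cap C) (con_cap C) (trans_cap C) (tech_cap C) k)"
  by (simp add: primal_feasible_def ball_players net_injection[OF assms])

lemma primal_objective_eq:
  assumes "valid_supply_chain C"
  shows "primal_objective C g d f \<xi> =
    - (\<Sum>k\<in>players C. profile (sup_bid C) (\<lambda>j. - con_bid C j) (trans_bid C) (tech_bid C) k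
         * profile g d f \<xi> k)"
  by (simp add: primal_objective_def sum_players[OF assms] sum_negf)

text \<open>Pricing a column of the incidence matrix: only the markets of one node \<open>s\<close> and of the products
  in \<open>Q\<close> contribute. With a singleton \<open>Q\<close> this covers suppliers, consumers and the two ends of a
  transport; for technologies, \<open>Q\<close> is the set of generated or of consumed products.\<close>
lemma sum_over_node_products:
  fixes h y :: "'s \<times> 'p \<Rightarrow> real"
  assumes "finite S" "finite P" "s \<in> S" "Q \<subseteq> P"
  shows "(\<Sum>e\<in>S \<times> P. h e * (of_bool (s = fst e \<and> snd e \<in> Q) * y e)) = (\<Sum>p\<in>Q. y (s, p) * h (s, p))"
proof -
  have "(\<Sum>p\<in>Q. y (s, p) * h (s, p)) = (\<Sum>e\<in>Pair s ` Q. y e * h e)"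
    by (simp add: sum.reindex inj_on_def)
  also have "\<dots> = (\<Sum>e\<in>S \<times> P. h e * (of_bool (s = fst e \<and> snd e \<in> Q) * y e))"
    using assms by (intro sum.mono_neutral_cong_left) auto
  finally show ?thesis ..
qed

text \<open>This makes the stakeholder prices the transpose of the clearing constraints. The price of a
  consumer appears negated, because a consumer withdraws what it buys.\<close>
lemma priced_injection:
  assumes "valid_supply_chain C" "k \<in> players C"
  shows "(\<Sum>e\<in>st_nodes C \<times> products C. \<pi> e * injection C e k) =
    profile (sup_price C (curry \<pi>)) (\<lambda>j. - con_price C (curry \<pi>) j) (trans_price C (curry \<pi>))
      (tech_price C (curry \<pi>)) k"
proof -
  note fin = valid_finite(1,2)[OF assms(1)]
  have single: "(\<Sum>e\<in>st_nodes C \<times> products C. \<pi> e * of_bool (s = fst e \<and> p = snd e)) = \<pi> (s, p)"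
    if "s \<in> st_nodes C" "p \<in> products C" for s p
    using sum_over_node_products[OF fin that(1), of "{p}" \<pi> "\<lambda>_. 1"] that(2)
    by (simp add: eq_commute[of p])
  have "\<forall>k\<in>players C. (\<Sum>e\<in>st_nodes C \<times> products C. \<pi> e * injection C e k) =
    profile (sup_price C (curry \<pi>)) (\<lambda>j. - con_price C (curry \<pi>) j) (trans_price C (curry \<pi>))
      (tech_price C (curry \<pi>)) k"
    unfolding ball_players
    using assms(1)
    by (auto simp: valid_supply_chain_def injection_def sup_price_def con_price_def
        trans_price_def tech_price_def case_prod_unfold right_diff_distrib sum_subtractf sum_negf
        single sum_over_node_products[OF fin])
  then show ?thesis
    using assms(2) by simp
qed

text \<open>For given prices, the admissible multipliers of a player are exactly those above the
  positive part of its surplus, which is what allows the multipliers to be eliminated.\<close>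
lemma dual_feasible_iff:
  assumes "valid_supply_chain C"
  shows "dual_feasible C (curry \<pi>) lam_g lam_d lam_f lam_\<xi> \<longleftrightarrow>
    (\<forall>k\<in>players C. max 0 ((\<Sum>e\<in>st_nodes C \<times> products C. \<pi> e * injection C e k)
        - profile (sup_bid C) (\<lambda>j. - con_bid C j) (trans_bid C) (tech_bid C) k)
      \<le> profile lam_g lam_d lam_f lam_\<xi> k)"
proof -
  have "dual_feasible C (curry \<pi>) lam_g lam_d lam_f lam_\<xi> \<longleftrightarrow>
    (\<forall>k\<in>players C. max 0 (profile (sup_price C (curry \<pi>)) (\<lambda>j. - con_price C (curry \<pi>) j)
          (trans_price C (curry \<pi>)) (tech_price C (curry \<pi>)) k
        - profile (sup_bid C) (\<lambda>j. - con_bid C j) (trans_bid C) (tech_bid C) k)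
      \<le> profile lam_g lam_d lam_f lam_\<xi> k)"
    unfolding ball_players dual_feasible_def by (auto simp: algebra_simps)
  then show ?thesis
    by (simp add: priced_injection[OF assms])
qed

lemma dual_objective_eq:
  assumes "valid_supply_chain C"
  shows "dual_objective C lam_g lam_d lam_f lam_\<xi> =
    (\<Sum>k\<in>players C. profile (sup_cap C) (con_cap C) (trans_cap C) (tech_cap C) k
       * profile lam_g lam_d lam_f lam_\<xi> k)"
  by (simp add: dual_objective_def sum_players[OF assms])

section \<open>Cleared players\<close>

theorem theorem5:
  fixes C :: "('n, 't::linorder, 'p, 'g, 'd, 'l, 'm) supply_chain"
    and g :: "'g \<Rightarrow> real" and d :: "'d \<Rightarrow> real" and f :: "'l \<Rightarrow> real" and \<xi> :: "'m \<Rightarrow> real"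
    and \<pi> :: "'n \<times> 't \<Rightarrow> 'p \<Rightarrow> real"
    and lam_g :: "'g \<Rightarrow> real" and lam_d :: "'d \<Rightarrow> real" and lam_f :: "'l \<Rightarrow> real" and lam_\<xi> :: "'m \<Rightarrow> real"
  assumes "valid_supply_chain C"
    and "primal_optimal C g d f \<xi>"
    and "dual_optimal C \<pi> lam_g lam_d lam_f lam_\<xi>"
  shows "(\<forall>i\<in>cleared (suppliers C) g. sup_price C \<pi> i \<ge> sup_bid C i) \<and>
         (\<forall>j\<in>cleared (consumers C) d. con_price C \<pi> j \<le> con_bid C j) \<and>
         (\<forall>l\<in>cleared (transports C) f. trans_price C \<pi> l \<ge> trans_bid C l) \<and>
         (\<forall>m\<in>cleared (technologies C) \<xi>. tech_price C \<pi> m \<ge> tech_bid C m)"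
proof -
  note valid = assms(1)
  define u where "u = profile (sup_cap C) (con_cap C) (trans_cap C) (tech_cap C)"
  define c where "c = profile (sup_bid C) (\<lambda>j. - con_bid C j) (trans_bid C) (tech_bid C)"
  define E where "E = st_nodes C \<times> products C"
  define \<rho> where "\<rho> = case_prod \<pi>"
  define r where "r \<pi> k = (\<Sum>e\<in>E. \<pi> e * injection C e k) - c k" for \<pi> k
  have u_nonneg: "\<forall>k\<in>players C. 0 \<le> u k"
    using valid by (auto simp: ball_players u_def valid_supply_chain_def)
  have feas: "primal_feasible C g d f \<xi>" and pmax: "\<And>g' d' f' \<xi>'. primal_feasible C g' d' f' \<xi>' \<Longrightarrow>
      primal_objective C g' d' f' \<xi>' \<le> primal_objective C g d f \<xi>"
    using assms(2) by (auto simp: primal_optimal_def)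
  have popt: "(\<Sum>k\<in>players C. c k * profile g d f \<xi> k) \<le> (\<Sum>k\<in>players C. c k * y k)"
    if "\<forall>e\<in>E. (\<Sum>k\<in>players C. injection C e k * y k) = 0"
      and "\<forall>k\<in>players C. 0 \<le> y k \<and> y k \<le> u k" for y
  proof -
    obtain g' d' f' \<xi>' where y: "y = profile g' d' f' \<xi>'"
      using profile_surj by blast
    then show ?thesis
      using pmax[of g' d' f' \<xi>'] that
      by (simp add: primal_feasible_iff[OF valid] primal_objective_eq[OF valid] u_def c_def E_def)
  qed
  \<comment> \<open>Any prices \<open>\<rho>'\<close>, with the least multipliers they allow, are a dual feasible competitor; and the
    given multipliers are at least the least ones for \<open>\<rho>\<close>.\<close>
  have dmin: "(\<Sum>k\<in>players C. u k * max 0 (r \<rho> k)) \<le> (\<Sum>k\<in>players C. u k * max 0 (r \<rho>' k))" for \<rho>'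
  proof -
    obtain h1 h2 h3 h4 where h: "(\<lambda>k. max 0 (r \<rho>' k)) = profile h1 h2 h3 h4"
      using profile_surj by blast
    have "dual_feasible C (curry \<rho>') h1 h2 h3 h4"
      unfolding dual_feasible_iff[OF valid] h[symmetric] by (simp add: r_def c_def E_def)
    then have "dual_objective C lam_g lam_d lam_f lam_\<xi> \<le> dual_objective C h1 h2 h3 h4"
      using assms(3) by (simp add: dual_optimal_def)
    also have "\<dots> = (\<Sum>k\<in>players C. u k * max 0 (r \<rho>' k))"
      by (simp add: dual_objective_eq[OF valid] u_def flip: h)
    finally have le: "dual_objective C lam_g lam_d lam_f lam_\<xi> \<le> \<dots>" .
    have "dual_feasible C (curry \<rho>) lam_g lam_d lam_f lam_\<xi>"
      using assms(3) by (simp add: dual_optimal_def \<rho>_def)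
    then have "\<forall>k\<in>players C. max 0 (r \<rho> k) \<le> profile lam_g lam_d lam_f lam_\<xi> k"
      unfolding dual_feasible_iff[OF valid] by (simp add: r_def c_def E_def)
    then have "(\<Sum>k\<in>players C. u k * max 0 (r \<rho> k)) \<le> dual_objective C lam_g lam_d lam_f lam_\<xi>"
      unfolding dual_objective_eq[OF valid] u_def[symmetric]
      using u_nonneg by (intro sum_mono mult_left_mono) auto
    then show ?thesis
      using le by linarith
  qed
  have "c k \<le> (\<Sum>e\<in>E. \<rho> e * injection C e k)" if "k \<in> players C" "0 < profile g d f \<xi> k" for k
  proof (rule box_lp_complementary_slackness[OF _ _ u_nonneg _ _ popt dmin[unfolded r_def] that])
    show "finite E" "finite (players C)"
      using valid_finite[OF valid] finite_players[OF valid] by (auto simp: E_def)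
    show "\<forall>e\<in>E. (\<Sum>k\<in>players C. injection C e k * profile g d f \<xi> k) = 0"
      "\<forall>k\<in>players C. 0 \<le> profile g d f \<xi> k \<and> profile g d f \<xi> k \<le> u k"
      using feas by (simp_all add: primal_feasible_iff[OF valid] E_def u_def)
  qed
  then have "\<forall>k\<in>players C. 0 < profile g d f \<xi> k \<longrightarrow>
      c k \<le> profile (sup_price C \<pi>) (\<lambda>j. - con_price C \<pi> j) (trans_price C \<pi>) (tech_price C \<pi>) k"
    by (simp add: priced_injection[OF valid] E_def \<rho>_def)
  then show ?thesis
    unfolding ball_players by (auto simp: cleared_def c_def)
qed

end
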